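(* Let $F\in\mathbb{R}^{M\times N}$, $\mathbf{y}\in\mathbb{R}^M$, and let $R\in\mathbb{R}^{K\times N}$ satisfy $\ker(F)\cap\ker(R)=\{\mathbf{0}_N\}$. Let $r,\tilde r\in\mathbb{R}\setminus\{0\}$, $\beta,\tilde\beta>0$, $\vartheta_1,\dots,\vartheta_K>0$, $\tilde\vartheta>0$, $\eta=r\beta-\tfrac32$, $\tilde\eta=\tilde r\tilde\beta-\tfrac{M+2}{2}$. Let $\mathcal{G}$ be the objective function and $\{(\mathbf{x}^{(k)},\boldsymbol{\theta}^{(k)},\nu^{(k)})\}$ the sequence of iterates of the generalized IAS algorithm, both defined in the context, started from an arbitrary $\mathbf{x}^{(0)}\in\mathbb{R}^N$. If $r,\tilde r\ge1$ and $\eta,\tilde\eta>0$, then $$(\mathbf{x}^{(k)},\boldsymbol{\theta}^{(k)},\nu^{(k)})\to(\mathbf{x}^{\mathrm{MAP}},\boldsymbol{\theta}^{\mathrm{MAP}},\nu^{\mathrm{MAP}})\quad\text{as }k\to\infty,$$ where $(\mathbf{x}^{\mathrm{MAP}},\boldsymbol{\theta}^{\mathrm{MAP}},\nu^{\mathrm{MAP}})$ is the unique global minimizer of $\mathcal{G}$.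
   Context: $D_{\boldsymbol{\theta}}=\operatorname{diag}(\theta_1,\dots,\theta_K)$. The objective $\mathcal{G}:\mathbb{R}^N\times\mathbb{R}^K\times\mathbb{R}\to\mathbb{R}\cup\{+\infty\}$ is $$\mathcal{G}(\mathbf{x},\boldsymbol{\theta},\nu)=\frac{1}{2\nu}\|F\mathbf{x}-\mathbf{y}\|_2^2+\frac12\|D_{\boldsymbol{\theta}}^{-1/2}R\mathbf{x}\|_2^2+\left(\frac{\nu}{\tilde\vartheta}\right)^{\tilde r}+\sum_{i=1}^K\left(\frac{\theta_i}{\vartheta_i}\right)^r-\tilde\eta\log\nu-\eta\sum_{i=1}^K\log\theta_i$$ if $\nu>0$ and all $\theta_i>0$, and $\mathcal{G}=+\infty$ otherwise. The generalized IAS algorithm is exact block-coordinate minimization: given $\mathbf{x}^{(0)}\in\mathbb{R}^N$, for $k=0,1,2,\dots$, $\boldsymbol{\theta}^{(k+1)}$ is the unique minimizer over $\boldsymbol{\theta}$ of $\mathcal{G}(\mathbf{x}^{(k)},\boldsymbol{\theta},\nu)$ (it does not depend on $\nu>0$); $\nu^{(k+1)}$ is the unique minimizer over $\nu$ of $\mathcal{G}(\mathbf{x}^{(k)},\boldsymbol{\theta}^{(k+1)},\nu)$; and $\mathbf{x}^{(k+1)}$ is the unique minimizer over $\mathbf{x}$ of $\mathcal{G}(\mathbf{x},\boldsymbol{\theta}^{(k+1)},\nu^{(k+1)})$. The sequence of iterates is indexed by $k\ge1$; no stopping criterion is applied. *)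

theory Defs
  imports "HOL-Analysis.Analysis"
begin

definition diag_mat :: "real ^ 'k \<Rightarrow> real ^ 'k ^ 'k" where
  "diag_mat v = (\<chi> i j. if i = j then v $ i else 0)"

definition diag_inv_sqrt :: "real ^ 'k \<Rightarrow> real ^ 'k ^ 'k" where
  "diag_inv_sqrt \<theta> = diag_mat (\<chi> i. \<theta> $ i powr (- 1 / 2))"

(* t stands for "tilde": rt, vt, etat are the parameters of the noise variance \<nu>,
   while r, v, eta are those of \<theta> (v = (vartheta_1, ..., vartheta_K)). *)
definition ias_objective ::
  "real ^ 'n ^ 'm \<Rightarrow> real ^ 'm \<Rightarrow> real ^ 'n ^ 'k \<Rightarrow> real \<Rightarrow> real \<Rightarrow> real ^ 'k \<Rightarrow> real \<Rightarrow> real \<Rightarrow> real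
   \<Rightarrow> real ^ 'n \<Rightarrow> real ^ 'k \<Rightarrow> real \<Rightarrow> ereal" where
  "ias_objective F y R r rt v vt eta etat x \<theta> \<nu> =
     (if \<nu> > 0 \<and> (\<forall>i. \<theta> $ i > 0) then
        ereal (1 / (2 * \<nu>) * (norm (F *v x - y))\<^sup>2
               + 1 / 2 * (norm (diag_inv_sqrt \<theta> *v (R *v x)))\<^sup>2
               + (\<nu> / vt) powr rt
               + (\<Sum>i\<in>UNIV. (\<theta> $ i / v $ i) powr r)
               - etat * ln \<nu>
               - eta * (\<Sum>i\<in>UNIV. ln (\<theta> $ i)))
      else \<infinity>)"

abbreviation is_minimizer :: "('a \<Rightarrow> ereal) \<Rightarrow> 'a \<Rightarrow> bool" where
  "is_minimizer f z \<equiv> is_arg_min f (\<lambda>_. True) z"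

definition the_minimizer :: "('a \<Rightarrow> ereal) \<Rightarrow> 'a" where
  "the_minimizer f = (THE z. is_minimizer f z)"

(* The \<theta>-update uses no previous value of \<nu>: it is the common minimizer for all \<nu> > 0. *)
definition theta_update :: "('x \<Rightarrow> 'p \<Rightarrow> real \<Rightarrow> ereal) \<Rightarrow> 'x \<Rightarrow> 'p" where
  "theta_update G x = (THE \<theta>. \<forall>\<nu>>0. is_minimizer (\<lambda>\<theta>'. G x \<theta>' \<nu>) \<theta>)"

definition ias_step :: "('x \<Rightarrow> 'p \<Rightarrow> real \<Rightarrow> ereal) \<Rightarrow> 'x \<Rightarrow> 'x \<times> 'p \<times> real" where
  "ias_step G x =
     (let \<theta> = theta_update G x;
          \<nu> = the_minimizer (\<lambda>\<nu>'. G x \<theta> \<nu>');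
          x' = the_minimizer (\<lambda>x''. G x'' \<theta> \<nu>)
      in (x', \<theta>, \<nu>))"

(* Only x0 is given initially; the two undefined components at index 0 are never used. *)
primrec ias_iterate ::
  "('x \<Rightarrow> 'p \<Rightarrow> real \<Rightarrow> ereal) \<Rightarrow> 'x \<Rightarrow> nat \<Rightarrow> 'x \<times> 'p \<times> real" where
  "ias_iterate G x0 0 = (x0, undefined, undefined)"
| "ias_iterate G x0 (Suc k) = ias_step G (fst (ias_iterate G x0 k))"

end

theory Submission
  imports Defs
begin

text \<open>The objective splits as a sum of a part in \<open>(x, \<nu>)\<close> and a part in \<open>(x, \<theta>)\<close>. Hence the
\<open>\<theta>\<close>-update followed by the \<open>\<nu>\<close>-update is one joint minimization over the pair \<open>(\<theta>, \<nu>)\<close>, and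
the algorithm is alternating minimization with only two blocks, \<open>x\<close> and \<open>(\<theta>, \<nu>)\<close>.

Three properties of the objective on its domain, where all \<open>\<theta> $ i\<close> and \<open>\<nu>\<close> are positive, carry the
proof.

\<^item> It is strictly convex in all variables jointly (\<open>ias_value_strictly_convex\<close>). The quadratic terms
  are of the form \<open>(norm u)\<^sup>2 / s\<close> and so jointly convex in \<open>(u, s)\<close>; each variance has a potential
  \<open>(s / v) powr r - \<eta> * ln s\<close>, which is strictly convex because \<open>r \<ge> 1\<close> and \<open>\<eta> > 0\<close>; and where the
  variances agree, the trivial intersection of the kernels makes the quadratic terms strictly convex
  in \<open>x\<close>.

\<^item> It is differentiable (\<open>ias_value_differentiable\<close>).

\<^item> Its sublevel sets are compact (\<open>ias_value_compact_sublevel\<close>). The potentials tend to infinity both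
  at \<open>0\<close> and at infinity, which keeps every variance in a compact subinterval of the positive axis;
  then the quadratic terms bound \<open>F *v x\<close> and \<open>R *v x\<close>, hence \<open>x\<close>.

Compactness and strict convexity give existence and uniqueness of the global minimizer and of all
partial minimizers. For convergence (\<open>alternating_minimization_converges\<close>), the values along the
iteration decrease to a limit, and compactness provides cluster points. At a cluster point neither
block can be improved separately. Both partial derivatives then vanish, so the full derivative does, and
a stationary point of a convex function is a global minimizer. Every cluster point is thus the unique
global minimizer, and a sequence in a compact set with a single cluster point converges to it.\<close>

section \<open>Minimizers of strictly convex functions\<close>

definition strictly_convex_on :: "'a::real_vector set \<Rightarrow> ('a \<Rightarrow> real) \<Rightarrow> bool" where
  "strictly_convex_on S f \<longleftrightarrow>
     (\<forall>a\<in>S. \<forall>b\<in>S. \<forall>t. a \<noteq> b \<and> 0 < t \<and> t < 1 \<longrightarrow>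
        f ((1 - t) *\<^sub>R a + t *\<^sub>R b) < (1 - t) * f a + t * f b)"

definition minimizes_on :: "'a set \<Rightarrow> ('a \<Rightarrow> real) \<Rightarrow> 'a \<Rightarrow> bool" where
  "minimizes_on S f z \<longleftrightarrow> z \<in> S \<and> (\<forall>w\<in>S. f z \<le> f w)"

lemma strictly_convex_onD:
  assumes "strictly_convex_on S f" "a \<in> S" "b \<in> S" "a \<noteq> b" "0 < t" "t < 1"
  shows "f ((1 - t) *\<^sub>R a + t *\<^sub>R b) < (1 - t) * f a + t * f b"
  using assms unfolding strictly_convex_on_def by blast

lemma minimizes_on_unique:
  assumes f: "strictly_convex_on D f" and S: "convex S" "S \<subseteq> D"
    and a: "minimizes_on S f a" and b: "minimizes_on S f b"
  shows "a = b"
proof (rule ccontr)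
  assume "a \<noteq> b"
  have mem: "a \<in> S" "b \<in> S" and eq: "f a = f b"
    using a b by (auto simp: minimizes_on_def intro: antisym)
  have "(1 - 1/2) *\<^sub>R a + (1/2) *\<^sub>R b \<in> S"
    using convexD_alt[OF S(1) mem, of "1/2"] by simp
  then have "f a \<le> f ((1 - 1/2) *\<^sub>R a + (1/2) *\<^sub>R b)"
    using a by (simp add: minimizes_on_def)
  also have "\<dots> < (1 - 1/2) * f a + (1/2) * f b"
    using strictly_convex_onD[OF f, of a b "1/2"] mem S(2) \<open>a \<noteq> b\<close> by auto
  finally show False using eq by simp
qed

text \<open>The set \<open>C\<close> prescribes the values of some of the variables. Compactness is available for
sublevel sets only, so the minimum is taken over the sublevel set of an arbitrary point of the slice.\<close>

lemma ex1_minimizes_on_slice: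
  fixes f :: "'a::euclidean_space \<Rightarrow> real"
  assumes f: "strictly_convex_on D f" "continuous_on D f"
    and sub: "\<And>c. compact {z \<in> D. f z \<le> c}"
    and D: "convex D" and C: "closed C" "convex C" and ne: "D \<inter> C \<noteq> {}"
  shows "\<exists>!z. minimizes_on (D \<inter> C) f z"
proof (rule ex_ex1I)
  obtain w where w: "w \<in> D" "w \<in> C" using ne by blast
  let ?K = "{z \<in> D. f z \<le> f w} \<inter> C"
  have K: "compact ?K" using sub C(1) by (rule compact_Int_closed)
  have "?K \<noteq> {}" using w by auto
  moreover have "continuous_on ?K f" using f(2) by (rule continuous_on_subset) auto
  ultimately have "\<exists>z\<in>?K. \<forall>u\<in>?K. f z \<le> f u"
    by (rule continuous_attains_inf[OF K])
  then obtain z where z: "z \<in> ?K" "\<forall>u\<in>?K. f z \<le> f u" ..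
  have "minimizes_on (D \<inter> C) f z"
    unfolding minimizes_on_def
  proof (intro conjI ballI)
    fix u assume u: "u \<in> D \<inter> C"
    show "f z \<le> f u"
    proof (cases "f u \<le> f w")
      case True then show ?thesis using z u by auto
    next
      case False
      moreover have "f z \<le> f w" using z(1) by simp
      ultimately show ?thesis by simp
    qed
  qed (use z in auto)
  then show "\<exists>z. minimizes_on (D \<inter> C) f z" ..
next
  fix a b assume "minimizes_on (D \<inter> C) f a" "minimizes_on (D \<inter> C) f b"
  then show "a = b"
    by (rule minimizes_on_unique[OF f(1) convex_Int[OF D C(2)] Int_lower1])
qed

text \<open>The same fact for a function of the free variables alone: \<open>e\<close> inserts them next to the prescribed ones.
This is the form in which the partial minimizers of the algorithm occur.\<close>

lemma ex1_minimizes_on_section: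
  fixes f :: "'a::euclidean_space \<Rightarrow> real"
  assumes f: "strictly_convex_on D f" "continuous_on D f"
    and sub: "\<And>c. compact {z \<in> D. f z \<le> c}"
    and D: "convex D" and C: "closed C" "convex C"
    and e: "D \<inter> C = e ` S" "inj e" "S \<noteq> {}"
  shows "\<exists>!s. minimizes_on S (\<lambda>s. f (e s)) s"
proof -
  have iff: "minimizes_on (D \<inter> C) f (e s) \<longleftrightarrow> minimizes_on S (\<lambda>s. f (e s)) s" for s
    unfolding minimizes_on_def e(1) using inj_image_mem_iff[OF e(2)] by auto
  have "\<exists>!z. minimizes_on (D \<inter> C) f z"
    using f sub D C by (rule ex1_minimizes_on_slice) (use e in auto)
  then obtain z where z: "minimizes_on (D \<inter> C) f z" and u: "\<And>w. minimizes_on (D \<inter> C) f w \<Longrightarrow> w = z"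
    by auto
  have "z \<in> e ` S" using z unfolding minimizes_on_def e(1) by simp
  then obtain s where s: "z = e s" by blast
  show ?thesis
  proof (rule ex1I[of _ s])
    show "minimizes_on S (\<lambda>s. f (e s)) s" using z iff s by simp
    fix s' assume "minimizes_on S (\<lambda>s. f (e s)) s'"
    then have "e s' = z" using u iff by blast
    then show "s' = s" using s e(2) by (simp add: inj_eq)
  qed
qed

text \<open>If \<open>w\<close> had a smaller value than \<open>z\<close>, convexity would force a decrease at a rate of at least \<open>f z - f w\<close>
along the segment from \<open>z\<close> to \<open>w\<close>, which a vanishing derivative excludes.\<close>

lemma stationary_imp_minimizes_on:
  fixes f :: "'a::real_normed_vector \<Rightarrow> real"
  assumes f: "strictly_convex_on D f" and z: "z \<in> D"
    and d: "(f has_derivative (\<lambda>h. 0)) (at z)"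
  shows "minimizes_on D f z"
  unfolding minimizes_on_def
proof (intro conjI ballI z)
  fix w assume w: "w \<in> D"
  show "f z \<le> f w"
  proof (rule ccontr)
    assume less: "\<not> f z \<le> f w"
    then have "z \<noteq> w" by auto
    let ?g = "\<lambda>t::real. f (z + t *\<^sub>R (w - z))"
    have "((\<lambda>t::real. z + t *\<^sub>R (w - z)) has_derivative (\<lambda>t. t *\<^sub>R (w - z))) (at 0)"
      by (auto intro!: derivative_eq_intros)
    moreover have "(f has_derivative (\<lambda>h. 0)) (at (z + 0 *\<^sub>R (w - z)))"
      using d by simp
    ultimately have "(?g has_derivative (\<lambda>h. 0)) (at 0)"
      by (rule has_derivative_compose)
    then have "(?g has_real_derivative 0) (at 0)"
      by (simp add: has_field_derivative_def lambda_zero)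
    then have "((\<lambda>t. (?g t - f z) / t) \<longlongrightarrow> 0) (at 0)"
      by (simp add: DERIV_def)
    then have lim: "((\<lambda>t. (?g t - f z) / t) \<longlongrightarrow> 0) (at_right 0)"
      by (rule filterlim_mono) (auto simp: at_le)
    have "eventually (\<lambda>t::real. t \<in> {0<..<1}) (at_right 0)"
      by (rule eventually_at_right_real) simp
    then have "eventually (\<lambda>t. (?g t - f z) / t \<le> f w - f z) (at_right 0)"
    proof (rule eventually_mono)
      fix t :: real assume t: "t \<in> {0<..<1}"
      have "z + t *\<^sub>R (w - z) = (1 - t) *\<^sub>R z + t *\<^sub>R w" by (simp add: algebra_simps)
      then have "?g t < (1 - t) * f z + t * f w"
        using strictly_convex_onD[OF f z w \<open>z \<noteq> w\<close>, of t] t by simp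
      then show "(?g t - f z) / t \<le> f w - f z"
        using t by (simp add: divide_simps algebra_simps)
    qed
    then have "0 \<le> f w - f z"
      by (rule tendsto_upperbound[OF lim]) simp
    then show False using less by simp
  qed
qed

section \<open>Convergence of two-block alternating minimization\<close>

text \<open>Differentiability is essential here: for a nonsmooth convex function such as
\<open>\<bar>x - p\<bar> + (x\<^sup>2 + p\<^sup>2) / 4\<close>, every point of the diagonal near the origin is minimal in each block
separately. For a differentiable function the derivative is the sum of its restrictions to the two
blocks, and each restriction vanishes at a blockwise minimum.\<close>

lemma blockwise_minimum_imp_minimizes_on:
  fixes f :: "'a::euclidean_space \<times> 'b::euclidean_space \<Rightarrow> real"
  assumes op: "open X" "open P" and f: "strictly_convex_on (X \<times> P) f"
    and d: "f differentiable (at (x, p))"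
    and x: "minimizes_on X (\<lambda>x. f (x, p)) x" and p: "minimizes_on P (\<lambda>p. f (x, p)) p"
  shows "minimizes_on (X \<times> P) f (x, p)"
proof -
  obtain f' where f': "(f has_derivative f') (at (x, p))"
    using d by (auto simp: differentiable_def)
  have "((\<lambda>u. (u, p)) has_derivative (\<lambda>h. (h, 0))) (at x)"
    by (auto intro!: derivative_eq_intros)
  then have "((\<lambda>u. f (u, p)) has_derivative (\<lambda>h. f' (h, 0))) (at x)"
    using f' by (rule has_derivative_compose)
  then have 1: "(\<lambda>h. f' (h, 0)) = (\<lambda>h. 0)"
    using x op(1) differential_zero_maxmin[of x X "\<lambda>u. f (u, p)"]
    by (auto simp: minimizes_on_def)
  have "((\<lambda>q. (x, q)) has_derivative (\<lambda>h. (0, h))) (at p)"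
    by (auto intro!: derivative_eq_intros)
  then have "((\<lambda>q. f (x, q)) has_derivative (\<lambda>h. f' (0, h))) (at p)"
    using f' by (rule has_derivative_compose)
  then have 2: "(\<lambda>h. f' (0, h)) = (\<lambda>h. 0)"
    using p op(2) differential_zero_maxmin[of p P "\<lambda>q. f (x, q)"]
    by (auto simp: minimizes_on_def)
  have "f' h = 0" for h
  proof -
    have "f' h = f' ((fst h, 0) + (0, snd h))" by simp
    also have "\<dots> = f' (fst h, 0) + f' (0, snd h)"
      by (rule linear_add[OF has_derivative_linear[OF f']])
    finally show ?thesis using 1 2 by (metis add_0)
  qed
  then have "f' = (\<lambda>h. 0)" by auto
  then show ?thesis
    using stationary_imp_minimizes_on[OF f _] f' x p by (auto simp: minimizes_on_def)
qed

text \<open>Along a subsequence, consecutive iterates \<open>(x\<^sub>k, p\<^sub>k)\<close> and \<open>(x\<^sub>k\<^sub>+\<^sub>1, p\<^sub>k\<^sub>+\<^sub>1)\<close> converge together, to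
\<open>(u, a)\<close> and \<open>(u', a')\<close>. The half step \<open>(x\<^sub>k, p\<^sub>k\<^sub>+\<^sub>1)\<close> tends to \<open>(u, a')\<close>. All three limits have the same
value, since the values decrease at each half step and converge. The minimality properties pass to the
limit, which makes \<open>(u, a')\<close> a blockwise and hence a global minimizer; so the common value is the
minimum and \<open>(u, a)\<close> attains it too.\<close>

theorem alternating_minimization_converges:
  fixes f :: "'a::euclidean_space \<times> 'b::euclidean_space \<Rightarrow> real"
  assumes op: "open X" "open P" and f: "strictly_convex_on (X \<times> P) f" and cv: "convex (X \<times> P)"
    and d: "\<And>z. z \<in> X \<times> P \<Longrightarrow> f differentiable (at z)"
    and sub: "\<And>c. compact {z \<in> X \<times> P. f z \<le> c}"
    and p: "\<And>k. minimizes_on P (\<lambda>q. f (x k, q)) (p (Suc k))"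
    and x: "\<And>k. minimizes_on X (\<lambda>u. f (u, p (Suc k))) (x (Suc k))"
    and zs: "minimizes_on (X \<times> P) f zs"
  shows "(\<lambda>k. (x k, p k)) \<longlonglongrightarrow> zs"
proof -
  \<comment> \<open>The shift skips the pair at index \<open>0\<close>, which may lie outside the domain.\<close>
  define z where "z k = (x (Suc k), p (Suc k))" for k
  have zD: "z k \<in> X \<times> P" for k
    using p[of k] x[of k] by (auto simp: z_def minimizes_on_def)
  have half: "f (z (Suc k)) \<le> f (x (Suc k), p (Suc (Suc k)))"
      "f (x (Suc k), p (Suc (Suc k))) \<le> f (z k)" for k
    using p[of "Suc k"] x[of "Suc k"] zD[of k] by (auto simp: z_def minimizes_on_def)
  have dec: "decseq (\<lambda>k. f (z k))"
    by (rule decseq_SucI) (meson half order_trans)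
  define K where "K = {w \<in> X \<times> P. f w \<le> f (z 0)}"
  have K: "compact K" unfolding K_def by (rule sub)
  have zK: "z k \<in> K" for k
    using zD dec decseqD[OF dec, of 0 k] by (auto simp: K_def)
  have contK: "(\<lambda>j. f (s j)) \<longlonglongrightarrow> f w" if "s \<longlonglongrightarrow> w" "w \<in> X \<times> P" for s w
    using isCont_tendsto_compose[OF differentiable_imp_continuous_within[OF d[OF that(2)]] that(1)] .
  have cluster: "l = zs" if r: "strict_mono r" and l: "l \<in> K" "(z \<circ> r) \<longlonglongrightarrow> l" for r l
  proof -
    have "(\<lambda>j. z (Suc (r j))) j \<in> K" for j by (rule zK)
    then obtain l' s where l': "l' \<in> K" "strict_mono s" "((\<lambda>j. z (Suc (r j))) \<circ> s) \<longlonglongrightarrow> l'"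
      using K unfolding compact_def by metis
    define q where "q = r \<circ> s"
    have q: "strict_mono q" unfolding q_def using r l'(2) by (rule strict_mono_o)
    have zq: "(\<lambda>j. z (q j)) \<longlonglongrightarrow> l"
      using LIMSEQ_subseq_LIMSEQ[OF l(2) l'(2)] by (simp add: q_def o_def)
    have zq': "(\<lambda>j. z (Suc (q j))) \<longlonglongrightarrow> l'"
      using l'(3) by (simp add: q_def o_def)
    obtain u a where ua: "l = (u, a)" by fastforce
    obtain u' a' where ua': "l' = (u', a')" by fastforce
    have memb: "u \<in> X" "a \<in> P" "u' \<in> X" "a' \<in> P"
      using l(1) l'(1) by (auto simp: K_def ua ua')
    have X: "(\<lambda>j. x (Suc (q j))) \<longlonglongrightarrow> u"
      using tendsto_fst[OF zq] by (simp add: z_def ua)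
    have P': "(\<lambda>j. p (Suc (Suc (q j)))) \<longlonglongrightarrow> a'"
      using tendsto_snd[OF zq'] by (simp add: z_def ua')
    have fl: "(\<lambda>j. f (z (q j))) \<longlonglongrightarrow> f (u, a)" and fl': "(\<lambda>j. f (z (Suc (q j)))) \<longlonglongrightarrow> f (u', a')"
      using contK[OF zq] contK[OF zq'] memb by (auto simp: ua ua')
    \<comment> \<open>the half step between the two iterates\<close>
    have fm: "(\<lambda>j. f (x (Suc (q j)), p (Suc (Suc (q j))))) \<longlonglongrightarrow> f (u, a')"
      using contK[OF tendsto_Pair[OF X P']] memb by auto
    have "\<And>k. f zs \<le> f (z k)" using zs zD by (metis minimizes_on_def)
    then obtain L where L: "(\<lambda>k. f (z k)) \<longlonglongrightarrow> L"
      using decseq_convergent[OF dec] by metis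
    have "(\<lambda>j. f (z (q j))) \<longlonglongrightarrow> L"
      using LIMSEQ_subseq_LIMSEQ[OF L q] by (simp add: o_def)
    then have La: "f (u, a) = L" using fl LIMSEQ_unique by blast
    have "strict_mono (\<lambda>j. Suc (q j))" using q by (simp add: strict_mono_def)
    then have "(\<lambda>j. f (z (Suc (q j)))) \<longlonglongrightarrow> L"
      using LIMSEQ_subseq_LIMSEQ[OF L] by (simp add: o_def)
    then have La': "f (u', a') = L" using fl' LIMSEQ_unique by blast
    have "f (u, a') \<le> f (u, a)" "f (u', a') \<le> f (u, a')"
      using LIMSEQ_le[OF fm fl] LIMSEQ_le[OF fl' fm] half by auto
    then have Lm: "f (u, a') = L" using La La' by simp
    have "minimizes_on P (\<lambda>b. f (u, b)) a'"
      unfolding minimizes_on_def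
    proof (intro conjI ballI memb)
      fix b assume b: "b \<in> P"
      have "(\<lambda>j. f (x (Suc (q j)), b)) \<longlonglongrightarrow> f (u, b)"
        using contK[OF tendsto_Pair[OF X tendsto_const]] memb b by auto
      then show "f (u, a') \<le> f (u, b)"
        using LIMSEQ_le[OF fm] p b by (auto simp: minimizes_on_def)
    qed
    moreover have "minimizes_on X (\<lambda>w. f (w, a')) u"
      unfolding minimizes_on_def
    proof (intro conjI ballI memb)
      fix w assume w: "w \<in> X"
      have "(\<lambda>j. f (w, p (Suc (Suc (q j))))) \<longlonglongrightarrow> f (w, a')"
        using contK[OF tendsto_Pair[OF tendsto_const P']] memb w by auto
      then have "f (u', a') \<le> f (w, a')"
        using LIMSEQ_le[OF fl'] x w by (auto simp: minimizes_on_def z_def)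
      then show "f (u, a') \<le> f (w, a')" using La' Lm by simp
    qed
    ultimately have "minimizes_on (X \<times> P) f (u, a')"
      using blockwise_minimum_imp_minimizes_on[OF op f d] memb by blast
    then have "minimizes_on (X \<times> P) f l"
      using memb La Lm by (simp add: minimizes_on_def ua)
    then show "l = zs" using minimizes_on_unique[OF f cv subset_refl] zs by blast
  qed
  have "z \<longlonglongrightarrow> zs"
  proof (rule ccontr)
    assume "\<not> z \<longlonglongrightarrow> zs"
    then obtain e where e: "e > 0" "\<And>n. \<exists>k\<ge>n. dist (z k) zs \<ge> e"
      unfolding lim_sequentially by (force simp: not_less)
    then have "infinite {k. dist (z k) zs \<ge> e}"
      by (auto simp: infinite_nat_iff_unbounded_le)
    then obtain r :: "nat \<Rightarrow> nat" where r: "strict_mono r" "\<And>j. dist (z (r j)) zs \<ge> e"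
      using infinite_enumerate by (metis mem_Collect_eq)
    obtain l s where l: "l \<in> K" "strict_mono s" "((\<lambda>j. z (r j)) \<circ> s) \<longlonglongrightarrow> l"
      using K zK unfolding compact_def by (metis (no_types, lifting))
    have "l = zs"
      using cluster[of "r \<circ> s" l] l r(1) strict_mono_o by (auto simp: o_def)
    moreover have "e \<le> dist l zs"
      by (rule tendsto_lowerbound[OF tendsto_dist[OF l(3) tendsto_const]]) (auto simp: r(2))
    ultimately show False using e(1) by simp
  qed
  then show ?thesis
    unfolding z_def by (rule LIMSEQ_imp_Suc)
qed

section \<open>Quadratic-over-linear functions\<close>

text \<open>The gap in the convexity inequality for \<open>(u, s) \<mapsto> (norm u)\<^sup>2 / s\<close> is an explicit positive multiple of
\<open>(norm (u / s - w / s'))\<^sup>2\<close>. This gives convexity, and strictness whenever the denominators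
agree and the numerators differ.\<close>

lemma quad_over_linear_convexity_gap:
  fixes u w :: "'a::real_inner"
  assumes s: "s > 0" "s' > 0" and t: "0 < t" "t < 1"
  shows "(norm ((1 - t) *\<^sub>R u + t *\<^sub>R w))\<^sup>2 / ((1 - t) * s + t * s')
      + (1 - t) * t * s * s' / ((1 - t) * s + t * s') * (norm (u /\<^sub>R s - w /\<^sub>R s'))\<^sup>2
    = (1 - t) * ((norm u)\<^sup>2 / s) + t * ((norm w)\<^sup>2 / s')"
proof -
  define S where "S = (1 - t) * s + t * s'"
  define a b c where "a = inner u u" "b = inner u w" "c = inner w w"
  have S: "S > 0" using assms by (simp add: S_def add_pos_pos)
  have 1: "(norm ((1 - t) *\<^sub>R u + t *\<^sub>R w))\<^sup>2 = (1 - t)\<^sup>2 * a + 2 * t * (1 - t) * b + t\<^sup>2 * c"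
    unfolding power2_norm_eq_inner a_b_c_def
    by (simp add: inner_add_left inner_add_right inner_commute[of w u] power2_eq_square algebra_simps)
  have 2: "(norm (u /\<^sub>R s - w /\<^sub>R s'))\<^sup>2 = a / s\<^sup>2 - 2 * b / (s * s') + c / s'\<^sup>2"
    unfolding power2_norm_eq_inner a_b_c_def
    by (simp add: inner_diff_left inner_diff_right inner_commute[of w u] power2_eq_square divide_inverse algebra_simps)
  have 3: "s * s' * (a / s\<^sup>2 - 2 * b / (s * s') + c / s'\<^sup>2) = a * s' / s - 2 * b + c * s / s'"
    using s by (simp add: field_simps power2_eq_square)
  have "(1 - t)\<^sup>2 * a + 2 * t * (1 - t) * b + t\<^sup>2 * c + (1 - t) * t * (a * s' / s - 2 * b + c * s / s')
      = ((1 - t) * (a / s) + t * (c / s')) * S"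
    using s unfolding S_def by (simp add: field_simps power2_eq_square)
  then have "((1 - t)\<^sup>2 * a + 2 * t * (1 - t) * b + t\<^sup>2 * c) / S
      + (1 - t) * t * (s * s' * (a / s\<^sup>2 - 2 * b / (s * s') + c / s'\<^sup>2)) / S
      = (1 - t) * (a / s) + t * (c / s')"
    unfolding 3 using S by (simp add: add_divide_distrib[symmetric])
  then show ?thesis
    unfolding 1 2 S_def[symmetric] by (simp add: power2_norm_eq_inner a_b_c_def mult.assoc)
qed

lemma quad_over_linear_convex:
  fixes u w :: "'a::real_inner"
  assumes "s > 0" "s' > 0" "0 < t" "t < 1"
  shows "(norm ((1 - t) *\<^sub>R u + t *\<^sub>R w))\<^sup>2 / ((1 - t) * s + t * s')
     \<le> (1 - t) * ((norm u)\<^sup>2 / s) + t * ((norm w)\<^sup>2 / s')"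
proof -
  have "(1 - t) * s + t * s' > 0" using assms by (simp add: add_pos_pos)
  then have "0 \<le> (1 - t) * t * s * s' / ((1 - t) * s + t * s') * (norm (u /\<^sub>R s - w /\<^sub>R s'))\<^sup>2"
    using assms by simp
  then show ?thesis using quad_over_linear_convexity_gap[OF assms, of u w] by linarith
qed

lemma quad_over_const_strict_convex:
  fixes u w :: "'a::real_inner"
  assumes "s > 0" "0 < t" "t < 1" "u \<noteq> w"
  shows "(norm ((1 - t) *\<^sub>R u + t *\<^sub>R w))\<^sup>2 / s
     < (1 - t) * ((norm u)\<^sup>2 / s) + t * ((norm w)\<^sup>2 / s)"
proof -
  have "u /\<^sub>R s - w /\<^sub>R s \<noteq> 0" using assms by simp
  then have "0 < (1 - t) * t * s * s / s * (norm (u /\<^sub>R s - w /\<^sub>R s))\<^sup>2"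
    using assms by simp
  moreover have "(1 - t) * s + t * s = s" by (simp add: algebra_simps)
  ultimately show ?thesis
    using quad_over_linear_convexity_gap[OF assms(1,1,2,3), of u w] by simp
qed

section \<open>Potentials of the variances\<close>

text \<open>Up to an additive constant, the negative logarithm of a generalized gamma density in \<open>s\<close> with scale
\<open>v\<close> and exponent \<open>r\<close>.\<close>

definition gamma_potential :: "real \<Rightarrow> real \<Rightarrow> real \<Rightarrow> real \<Rightarrow> real" where
  "gamma_potential r v \<eta> s = (s / v) powr r - \<eta> * ln s"

text \<open>The tangent inequality \<open>ln c \<le> ln m + c / m - 1\<close> at the convex combination \<open>m\<close> is strict for \<open>c \<noteq> m\<close>, and
its average over the two end points is the claim.\<close>

lemma ln_strictly_concave:
  fixes a b :: real
  assumes "a > 0" "b > 0" "a \<noteq> b" "0 < t" "t < 1"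
  shows "(1 - t) * ln a + t * ln b < ln ((1 - t) * a + t * b)"
proof -
  define m where "m = (1 - t) * a + t * b"
  have m: "m > 0" using assms by (simp add: m_def add_pos_pos)
  have am: "a \<noteq> m"
  proof
    assume "a = m"
    then have "t * (b - a) = 0" unfolding m_def by algebra
    then show False using assms by simp
  qed
  have ln: "ln c - ln m \<le> c / m - 1" if "c > 0" for c
    using ln_le_minus_one[of "c / m"] that m by (simp add: ln_div)
  have "ln a - ln m < a / m - 1"
    using ln[OF assms(1)] ln_eq_minus_one[of "a / m"] assms(1) m am
    by (fastforce simp: ln_div less_le)
  then have "(1 - t) * (ln a - ln m) < (1 - t) * (a / m - 1)"
    using assms by simp
  moreover have "t * (ln b - ln m) \<le> t * (b / m - 1)"
    using ln[OF assms(2)] assms by simp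
  moreover have "(1 - t) * (a / m - 1) + t * (b / m - 1) = ((1 - t) * a + t * b) / m - 1"
    by (simp add: algebra_simps add_divide_distrib diff_divide_distrib)
  ultimately have "(1 - t) * (ln a - ln m) + t * (ln b - ln m) < 0"
    using m unfolding m_def[symmetric] by simp
  then show ?thesis unfolding m_def[symmetric] by (simp add: algebra_simps)
qed

lemma gamma_potential_strict_convex:
  assumes "r \<ge> 1" "v > 0" "\<eta> > 0" "a > 0" "b > 0" "a \<noteq> b" "0 < t" "t < 1"
  shows "gamma_potential r v \<eta> ((1 - t) * a + t * b)
    < (1 - t) * gamma_potential r v \<eta> a + t * gamma_potential r v \<eta> b"
proof -
  have "((1 - t) *\<^sub>R (a / v) + t *\<^sub>R (b / v)) powr r \<le> (1 - t) * (a / v) powr r + t * (b / v) powr r"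
    by (rule convex_onD[OF powr_convex[OF assms(1)]]) (use assms in auto)
  moreover have "(1 - t) *\<^sub>R (a / v) + t *\<^sub>R (b / v) = ((1 - t) * a + t * b) / v"
    by (simp add: add_divide_distrib)
  moreover have "\<eta> * ((1 - t) * ln a + t * ln b) < \<eta> * ln ((1 - t) * a + t * b)"
    using ln_strictly_concave assms by simp
  ultimately show ?thesis
    unfolding gamma_potential_def by (simp add: algebra_simps)
qed

text \<open>The power term dominates \<open>s / v - 1\<close>, and half of this linear growth absorbs the logarithm.\<close>

lemma gamma_potential_ge_linear:
  assumes "r \<ge> 1" "v > 0" "\<eta> > 0"
  obtains C where "\<And>s. s > 0 \<Longrightarrow> gamma_potential r v \<eta> s \<ge> s / (2 * v) - C"
proof
  fix s :: real assume s: "s > 0"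
  have "s / v - 1 \<le> (s / v) powr r"
  proof (cases "s / v \<ge> 1")
    case True
    then have "(s / v) powr 1 \<le> (s / v) powr r" using assms(1) by (intro powr_mono)
    then show ?thesis using s assms(2) by simp
  next
    case False
    then have "s / v - 1 \<le> 0" by simp
    also have "0 \<le> (s / v) powr r" by simp
    finally show ?thesis .
  qed
  moreover have "ln (s / (2 * v * \<eta>)) \<le> s / (2 * v * \<eta>) - 1"
    using s assms by (intro ln_le_minus_one) simp
  then have "ln s \<le> s / (2 * v * \<eta>) - 1 + ln (2 * v * \<eta>)"
    using s assms ln_div[of s "2 * v * \<eta>"] by simp
  then have "\<eta> * ln s \<le> \<eta> * (s / (2 * v * \<eta>) - 1 + ln (2 * v * \<eta>))"
    using assms(3) by simp
  moreover have "\<dots> = s / (2 * v) + \<eta> * (ln (2 * v * \<eta>) - 1)"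
    using assms by (simp add: field_simps)
  moreover have "s / v = s / (2 * v) + s / (2 * v)" by simp
  ultimately show "gamma_potential r v \<eta> s \<ge> s / (2 * v) - (1 + \<eta> * (ln (2 * v * \<eta>) - 1))"
    unfolding gamma_potential_def by linarith
qed

lemma gamma_potential_bounded_below:
  assumes "r \<ge> 1" "v > 0" "\<eta> > 0"
  obtains C where "\<And>s. s > 0 \<Longrightarrow> C \<le> gamma_potential r v \<eta> s"
proof -
  obtain C where C: "\<And>s. s > 0 \<Longrightarrow> gamma_potential r v \<eta> s \<ge> s / (2 * v) - C"
    using gamma_potential_ge_linear[OF assms] by blast
  show ?thesis
  proof (rule that[of "- C"])
    fix s :: real assume "s > 0"
    then show "- C \<le> gamma_potential r v \<eta> s" using C[of s] assms(2) by (smt (verit) divide_pos_pos)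
  qed
qed

text \<open>The logarithm bounds \<open>s\<close> away from \<open>0\<close>, where the power term is merely nonnegative; the linear growth
bounds \<open>s\<close> from above.\<close>

lemma gamma_potential_sublevel:
  assumes "r \<ge> 1" "v > 0" "\<eta> > 0"
  obtains a b where "a > 0" "\<And>s. s > 0 \<Longrightarrow> gamma_potential r v \<eta> s \<le> c \<Longrightarrow> a \<le> s \<and> s \<le> b"
proof -
  obtain C where C: "\<And>s. s > 0 \<Longrightarrow> gamma_potential r v \<eta> s \<ge> s / (2 * v) - C"
    using gamma_potential_ge_linear[OF assms] by blast
  show ?thesis
  proof (rule that[of "exp (- c / \<eta>)" "2 * v * (c + C)"])
    fix s :: real assume s: "s > 0" and le: "gamma_potential r v \<eta> s \<le> c"
    have "0 \<le> (s / v) powr r" by simp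
    then have "- (\<eta> * ln s) \<le> c" using le unfolding gamma_potential_def by linarith
    then have "- c / \<eta> \<le> ln s" using assms(3) by (simp add: field_simps)
    moreover have "s / (2 * v) \<le> c + C" using C[OF s] le by simp
    then have "s \<le> 2 * v * (c + C)" using assms(2) by (simp add: field_simps)
    ultimately show "exp (- c / \<eta>) \<le> s \<and> s \<le> 2 * v * (c + C)"
      using s by (simp add: ln_ge_iff)
  qed simp
qed

lemma gamma_potential_differentiable:
  fixes g :: "'a::real_normed_vector \<Rightarrow> real"
  assumes "g differentiable (at z)" "g z > 0" "v > 0"
  shows "(\<lambda>z. gamma_potential r v \<eta> (g z)) differentiable (at z)"
proof -
  obtain g' where g: "(g has_derivative g') (at z)" using assms(1) by (auto simp: differentiable_def)
  have "0 < g z / v" using assms by simp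
  then show ?thesis
    unfolding gamma_potential_def differentiable_def
    using assms(2,3) by (auto intro!: exI derivative_eq_intros g)
qed

section \<open>The objective\<close>

definition ias_domain :: "((real ^ 'n) \<times> (real ^ 'k) \<times> real) set" where
  "ias_domain = UNIV \<times> {\<theta>. \<forall>i. \<theta> $ i > 0} \<times> {0<..}"

text \<open>The finite part of the objective, with the quadratic terms in the form \<open>(norm u)\<^sup>2 / s\<close> and the remaining
terms grouped by variance.\<close>

definition ias_value ::
  "real ^ 'n ^ 'm \<Rightarrow> real ^ 'm \<Rightarrow> real ^ 'n ^ 'k \<Rightarrow> real \<Rightarrow> real \<Rightarrow> real ^ 'k \<Rightarrow> real \<Rightarrow> real \<Rightarrow> real
   \<Rightarrow> (real ^ 'n) \<times> (real ^ 'k) \<times> real \<Rightarrow> real" where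
  "ias_value F y R r rt v vt eta etat = (\<lambda>(x, \<theta>, \<nu>).
     ((norm (F *v x - y))\<^sup>2 / \<nu>) / 2 + (\<Sum>i\<in>UNIV. (norm ((R *v x) $ i))\<^sup>2 / \<theta> $ i) / 2
     + gamma_potential rt vt etat \<nu> + (\<Sum>i\<in>UNIV. gamma_potential r (v $ i) eta (\<theta> $ i)))"

lemma norm_diag_inv_sqrt:
  assumes "\<forall>i. \<theta> $ i > 0"
  shows "(norm (diag_inv_sqrt \<theta> *v w))\<^sup>2 = (\<Sum>i\<in>UNIV. (w $ i)\<^sup>2 / \<theta> $ i)"
proof -
  have "(diag_inv_sqrt \<theta> *v w) $ i = \<theta> $ i powr (- 1 / 2) * w $ i" for i
    by (simp add: diag_inv_sqrt_def diag_mat_def matrix_vector_mult_def if_distrib[of "\<lambda>x. x * _"] cong: if_cong)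
  moreover have "(\<theta> $ i powr (- 1 / 2) * w $ i)\<^sup>2 = (w $ i)\<^sup>2 / \<theta> $ i" for i
  proof -
    have "(\<theta> $ i powr (- 1 / 2))\<^sup>2 = 1 / \<theta> $ i"
      using assms by (simp add: powr_minus_divide powr_half_sqrt power_divide less_imp_le)
    then show ?thesis by (simp add: power_mult_distrib)
  qed
  moreover have "0 \<le> (\<Sum>i\<in>UNIV. (w $ i)\<^sup>2 / \<theta> $ i)"
    using assms by (intro sum_nonneg divide_nonneg_nonneg) (auto intro: less_imp_le)
  ultimately show ?thesis
    by (simp add: norm_vec_def L2_set_def)
qed

lemma ias_objective_eq:
  "ias_objective F y R r rt v vt eta etat x \<theta> \<nu> =
    (if (x, \<theta>, \<nu>) \<in> ias_domain then ereal (ias_value F y R r rt v vt eta etat (x, \<theta>, \<nu>)) else \<infinity>)"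
proof (cases "(x, \<theta>, \<nu>) \<in> ias_domain")
  case True
  then have pos: "\<nu> > 0" "\<forall>i. \<theta> $ i > 0" by (simp_all add: ias_domain_def)
  have 1: "1 / 2 * (norm (diag_inv_sqrt \<theta> *v (R *v x)))\<^sup>2
      = (\<Sum>i\<in>UNIV. (norm ((R *v x) $ i))\<^sup>2 / \<theta> $ i) / 2"
    by (simp add: norm_diag_inv_sqrt[OF pos(2)])
  have 2: "(\<Sum>i\<in>UNIV. gamma_potential r (v $ i) eta (\<theta> $ i))
      = (\<Sum>i\<in>UNIV. (\<theta> $ i / v $ i) powr r) - eta * (\<Sum>i\<in>UNIV. ln (\<theta> $ i))"
    by (simp add: gamma_potential_def sum_subtractf sum_distrib_left)
  have 3: "1 / (2 * \<nu>) * (norm (F *v x - y))\<^sup>2 = ((norm (F *v x - y))\<^sup>2 / \<nu>) / 2"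
    by simp
  show ?thesis
    using True pos unfolding ias_objective_def ias_value_def prod.case 1 2 3
    by (simp add: gamma_potential_def)
next
  case False
  then show ?thesis by (auto simp: ias_objective_def ias_domain_def)
qed

lemma open_pos_orthant: "open {\<theta> :: real ^ 'k. \<forall>i. \<theta> $ i > 0}"
proof -
  have "{\<theta> :: real ^ 'k. \<forall>i. \<theta> $ i > 0} = (\<Inter>i\<in>UNIV. {\<theta>. 0 < \<theta> $ i})" by auto
  then show ?thesis by (auto intro!: open_INT open_Collect_less continuous_intros)
qed

lemma convex_ias_domain: "convex ias_domain"
  unfolding ias_domain_def
  by (intro convex_Times convex_UNIV convex_box_cart) (auto simp flip: greaterThan_def)

lemma sum_le_convex_combination:
  fixes g h k :: "'i \<Rightarrow> real"
  assumes "\<And>i. i \<in> I \<Longrightarrow> g i \<le> (1 - t) * h i + t * k i"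
  shows "sum g I \<le> (1 - t) * sum h I + t * sum k I"
  using sum_mono[of I g "\<lambda>i. (1 - t) * h i + t * k i"] assms
  by (simp add: sum.distrib sum_distrib_left)

lemma sum_less_convex_combination:
  fixes g h k :: "'i \<Rightarrow> real"
  assumes "finite I" "\<And>i. i \<in> I \<Longrightarrow> g i \<le> (1 - t) * h i + t * k i"
    and "j \<in> I" "g j < (1 - t) * h j + t * k j"
  shows "sum g I < (1 - t) * sum h I + t * sum k I"
  using sum_strict_mono_ex1[of I g "\<lambda>i. (1 - t) * h i + t * k i"] assms
  by (auto simp: sum.distrib sum_distrib_left)

text \<open>All four groups of terms are convex, so it suffices that one of them is strictly convex between the two
given points. If a variance differs, its potential is strict. Otherwise the points differ in \<open>x\<close>, and by the
kernel condition \<open>F *v x\<close> or some component of \<open>R *v x\<close> differs, while the denominators agree.\<close>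

lemma ias_value_strictly_convex:
  fixes F :: "real ^ 'n ^ 'm" and R :: "real ^ 'n ^ 'k"
  assumes ker: "{x. F *v x = 0} \<inter> {x. R *v x = 0} = {0}"
    and r: "r \<ge> 1" "rt \<ge> 1" and v: "\<And>i. v $ i > 0" "vt > 0" and eta: "eta > 0" "etat > 0"
  shows "strictly_convex_on ias_domain (ias_value F y R r rt v vt eta etat)"
  unfolding strictly_convex_on_def
proof (intro ballI allI impI)
  fix z w :: "(real ^ 'n) \<times> (real ^ 'k) \<times> real" and t :: real
  assume z: "z \<in> ias_domain" and w: "w \<in> ias_domain" and "z \<noteq> w \<and> 0 < t \<and> t < 1"
  then have zw: "z \<noteq> w" and t: "0 < t" "t < 1" by auto
  obtain x \<theta> \<nu> where z_eq: "z = (x, \<theta>, \<nu>)" by (cases z) auto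
  obtain x' \<theta>' \<nu>' where w_eq: "w = (x', \<theta>', \<nu>')" by (cases w) auto
  have pos: "\<nu> > 0" "\<nu>' > 0" "\<And>i. \<theta> $ i > 0" "\<And>i. \<theta>' $ i > 0"
    using z w by (auto simp: z_eq w_eq ias_domain_def)
  define xm \<theta>m \<nu>m where "xm = (1 - t) *\<^sub>R x + t *\<^sub>R x'"
    and "\<theta>m = (1 - t) *\<^sub>R \<theta> + t *\<^sub>R \<theta>'" and "\<nu>m = (1 - t) * \<nu> + t * \<nu>'"
  note m_defs = xm_def \<theta>m_def \<nu>m_def
  define A B P Q where "A = (\<lambda>x \<nu>. (norm (F *v x - y))\<^sup>2 / \<nu>)"
    and "B = (\<lambda>x (\<theta> :: real ^ 'k). \<Sum>i\<in>UNIV. (norm ((R *v x) $ i))\<^sup>2 / \<theta> $ i)"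
    and "P = gamma_potential rt vt etat"
    and "Q = (\<lambda>\<theta>. \<Sum>i\<in>UNIV. gamma_potential r (v $ i) eta (\<theta> $ i))"
  have Fm: "F *v xm - y = (1 - t) *\<^sub>R (F *v x - y) + t *\<^sub>R (F *v x' - y)"
    by (simp add: xm_def matrix_vector_right_distrib matrix_vector_mult_scaleR algebra_simps)
  have Rm: "(R *v xm) $ i = (1 - t) *\<^sub>R (R *v x) $ i + t *\<^sub>R (R *v x') $ i" for i
    by (simp add: xm_def matrix_vector_right_distrib matrix_vector_mult_scaleR)
  have A: "A xm \<nu>m \<le> (1 - t) * A x \<nu> + t * A x' \<nu>'"
    unfolding A_def Fm \<nu>m_def by (rule quad_over_linear_convex[OF pos(1,2) t])
  have Bi: "(norm ((R *v xm) $ i))\<^sup>2 / \<theta>m $ i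
      \<le> (1 - t) * ((norm ((R *v x) $ i))\<^sup>2 / \<theta> $ i) + t * ((norm ((R *v x') $ i))\<^sup>2 / \<theta>' $ i)" for i
    using quad_over_linear_convex[OF pos(3)[of i] pos(4)[of i] t, of "(R *v x) $ i" "(R *v x') $ i"]
    unfolding Rm by (simp add: \<theta>m_def)
  have B: "B xm \<theta>m \<le> (1 - t) * B x \<theta> + t * B x' \<theta>'"
    unfolding B_def by (rule sum_le_convex_combination[OF Bi])
  have P_less: "P \<nu>m < (1 - t) * P \<nu> + t * P \<nu>'" if "\<nu> \<noteq> \<nu>'"
    unfolding P_def \<nu>m_def
    by (rule gamma_potential_strict_convex[OF r(2) v(2) eta(2) pos(1,2) that t])
  have P: "P \<nu>m \<le> (1 - t) * P \<nu> + t * P \<nu>'"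
    using P_less by (cases "\<nu> = \<nu>'") (auto simp: \<nu>m_def algebra_simps)
  have Qi_less: "gamma_potential r (v $ i) eta (\<theta>m $ i)
      < (1 - t) * gamma_potential r (v $ i) eta (\<theta> $ i) + t * gamma_potential r (v $ i) eta (\<theta>' $ i)"
    if "\<theta> $ i \<noteq> \<theta>' $ i" for i
    using gamma_potential_strict_convex[OF r(1) v(1)[of i] eta(1) pos(3)[of i] pos(4)[of i] that t]
    by (simp add: \<theta>m_def)
  have Qi: "gamma_potential r (v $ i) eta (\<theta>m $ i)
      \<le> (1 - t) * gamma_potential r (v $ i) eta (\<theta> $ i) + t * gamma_potential r (v $ i) eta (\<theta>' $ i)" for i
    using Qi_less[of i] by (cases "\<theta> $ i = \<theta>' $ i") (auto simp: \<theta>m_def algebra_simps)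
  have Q: "Q \<theta>m \<le> (1 - t) * Q \<theta> + t * Q \<theta>'"
    unfolding Q_def by (rule sum_le_convex_combination[OF Qi])
  have "A xm \<nu>m < (1 - t) * A x \<nu> + t * A x' \<nu>' \<or> B xm \<theta>m < (1 - t) * B x \<theta> + t * B x' \<theta>'
    \<or> P \<nu>m < (1 - t) * P \<nu> + t * P \<nu>' \<or> Q \<theta>m < (1 - t) * Q \<theta> + t * Q \<theta>'"
  proof (cases "\<nu> = \<nu>' \<and> \<theta> = \<theta>'")
    case False
    then consider "\<nu> \<noteq> \<nu>'" | i where "\<theta> $ i \<noteq> \<theta>' $ i" by (auto simp: vec_eq_iff)
    then show ?thesis
    proof cases
      case 1
      then show ?thesis using P_less by blast
    next
      case 2
      have "Q \<theta>m < (1 - t) * Q \<theta> + t * Q \<theta>'"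
        unfolding Q_def
        by (intro sum_less_convex_combination[where j = i] finite UNIV_I Qi Qi_less[OF 2])
      then show ?thesis by blast
    qed
  next
    case True
    then have m: "\<nu>m = \<nu>" "\<theta>m = \<theta>" by (simp_all add: m_defs algebra_simps)
    have "x - x' \<noteq> 0" using zw True by (auto simp: z_eq w_eq)
    then have "\<not> (F *v (x - x') = 0 \<and> R *v (x - x') = 0)" using ker by blast
    then consider "F *v x \<noteq> F *v x'" | i where "(R *v x) $ i \<noteq> (R *v x') $ i"
      by (auto simp: matrix_vector_mult_diff_distrib vec_eq_iff)
    then show ?thesis
    proof cases
      case 1
      then have "F *v x - y \<noteq> F *v x' - y" by simp
      then have "A xm \<nu> < (1 - t) * A x \<nu> + t * A x' \<nu>"
        unfolding A_def Fm by (rule quad_over_const_strict_convex[OF pos(1) t])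
      then show ?thesis using True m by simp
    next
      case 2
      then have "(norm ((R *v xm) $ i))\<^sup>2 / \<theta>m $ i
        < (1 - t) * ((norm ((R *v x) $ i))\<^sup>2 / \<theta> $ i) + t * ((norm ((R *v x') $ i))\<^sup>2 / \<theta>' $ i)"
        using quad_over_const_strict_convex[OF pos(3)[of i] t 2] True
        unfolding Rm m by simp
      then have "B xm \<theta>m < (1 - t) * B x \<theta> + t * B x' \<theta>'"
        unfolding B_def by (intro sum_less_convex_combination[where j = i] finite UNIV_I Bi)
      then show ?thesis by blast
    qed
  qed
  then have "A xm \<nu>m / 2 + B xm \<theta>m / 2 + P \<nu>m + Q \<theta>m
     < (1 - t) * (A x \<nu> / 2 + B x \<theta> / 2 + P \<nu> + Q \<theta>) + t * (A x' \<nu>' / 2 + B x' \<theta>' / 2 + P \<nu>' + Q \<theta>')"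
    using A B P Q unfolding distrib_left by (auto simp: field_simps)
  then show "ias_value F y R r rt v vt eta etat ((1 - t) *\<^sub>R z + t *\<^sub>R w)
      < (1 - t) * ias_value F y R r rt v vt eta etat z + t * ias_value F y R r rt v vt eta etat w"
    by (simp add: z_eq w_eq ias_value_def A_def B_def P_def Q_def m_defs)
qed

lemma ias_value_differentiable:
  fixes F :: "real ^ 'n ^ 'm" and R :: "real ^ 'n ^ 'k"
  assumes "z \<in> ias_domain" "\<And>i. v $ i > 0" "vt > 0"
  shows "ias_value F y R r rt v vt eta etat differentiable (at z)"
proof -
  have dF: "(\<lambda>z :: (real ^ 'n) \<times> (real ^ 'k) \<times> real. F *v fst z) differentiable (at z)"
    by (intro bounded_linear_imp_differentiable
        bounded_linear_compose[OF matrix_vector_mul_bounded_linear bounded_linear_fst])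
  have dR: "(\<lambda>z :: (real ^ 'n) \<times> (real ^ 'k) \<times> real. (R *v fst z) $ i) differentiable (at z)" for i
    by (intro bounded_linear_imp_differentiable bounded_linear_compose[OF bounded_linear_vec_nth]
        bounded_linear_compose[OF matrix_vector_mul_bounded_linear bounded_linear_fst])
  have d\<theta>: "(\<lambda>z :: (real ^ 'n) \<times> (real ^ 'k) \<times> real. fst (snd z) $ i) differentiable (at z)" for i
    by (intro bounded_linear_imp_differentiable bounded_linear_compose[OF bounded_linear_vec_nth]
        bounded_linear_compose[OF bounded_linear_fst bounded_linear_snd])
  have d\<nu>: "(\<lambda>z :: (real ^ 'n) \<times> (real ^ 'k) \<times> real. snd (snd z)) differentiable (at z)"
    by (intro bounded_linear_imp_differentiable
        bounded_linear_compose[OF bounded_linear_snd bounded_linear_snd])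
  have eq: "ias_value F y R r rt v vt eta etat = (\<lambda>z.
     (((F *v fst z - y) \<bullet> (F *v fst z - y)) / snd (snd z)) / 2
     + (\<Sum>i\<in>UNIV. ((R *v fst z) $ i * (R *v fst z) $ i) / fst (snd z) $ i) / 2
     + gamma_potential rt vt etat (snd (snd z))
     + (\<Sum>i\<in>UNIV. gamma_potential r (v $ i) eta (fst (snd z) $ i)))"
    by (auto simp: ias_value_def dot_square_norm power2_eq_square fun_eq_iff)
  have pos: "snd (snd z) > 0" "\<And>i. fst (snd z) $ i > 0" using assms(1) by (auto simp: ias_domain_def)
  show ?thesis
    unfolding eq
    by (intro differentiable_add differentiable_divide differentiable_sum differentiable_inner
        differentiable_diff differentiable_mult differentiable_const dF dR d\<theta> d\<nu> ballI finite
        gamma_potential_differentiable pos assms(2,3))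
      (use pos in \<open>auto simp: less_imp_neq[symmetric]\<close>)
qed

text \<open>The linear map \<open>x \<mapsto> (F *v x, R *v x)\<close> is injective by the kernel condition, and an injective linear map on a
finite-dimensional space is bounded below.\<close>

lemma norm_bounded_by_residuals_of_trivial_kernels:
  fixes F :: "real ^ 'n ^ 'm" and R :: "real ^ 'n ^ 'k"
  assumes ker: "{x. F *v x = 0} \<inter> {x. R *v x = 0} = {0}"
  obtains b where "\<And>x. norm (F *v x - y) \<le> a \<Longrightarrow> (\<And>i. \<bar>(R *v x) $ i\<bar> \<le> a) \<Longrightarrow> norm x \<le> b"
proof -
  let ?L = "\<lambda>x. (F *v x, R *v x)"
  have lin: "linear ?L"
    by (intro bounded_linear.linear bounded_linear_Pair matrix_vector_mul_bounded_linear)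
  have "inj ?L"
    unfolding linear_injective_0[OF lin] using ker by (auto simp: zero_prod_def)
  then obtain c where c: "c > 0" "\<And>x. c * norm x \<le> norm (?L x)"
    using linear_inj_bounded_below_pos[OF lin] by blast
  show ?thesis
  proof (rule that[of "(a + norm y + (\<Sum>i\<in>(UNIV::'k set). a)) / c"])
    fix x assume F: "norm (F *v x - y) \<le> a" and R: "\<And>i. \<bar>(R *v x) $ i\<bar> \<le> a"
    have "norm (F *v x) \<le> a + norm y"
      using F norm_triangle_ineq[of "F *v x - y" y] by simp
    moreover have "norm (R *v x) \<le> (\<Sum>i\<in>(UNIV::'k set). a)"
      using norm_le_l1_cart[of "R *v x"] sum_mono[of UNIV "\<lambda>i. \<bar>(R *v x) $ i\<bar>" "\<lambda>_. a"] R by simp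
    moreover have "norm (?L x) \<le> norm (F *v x) + norm (R *v x)"
      using sqrt_sum_squares_le_sum_abs[of "norm (F *v x)" "norm (R *v x)"] by (simp add: norm_Pair)
    ultimately have "norm x * c \<le> a + norm y + (\<Sum>i\<in>(UNIV::'k set). a)"
      using c(2)[of x] by (simp add: mult.commute)
    then show "norm x \<le> (a + norm y + (\<Sum>i\<in>(UNIV::'k set). a)) / c"
      using c(1) by (simp add: pos_le_divide_eq)
  qed
qed

text \<open>Every term is bounded below, so an upper bound on the sum bounds each term from above by its own lower
bound plus the common slack \<open>e\<close>. Bounded potentials confine the variances to compact intervals inside the
positive axis; then bounded quotients \<open>(norm u)\<^sup>2 / s\<close> with bounded \<open>s\<close> bound \<open>u\<close>. The sublevel set is thus
contained in a compact subset \<open>K\<close> of the domain, on which the objective is continuous.\<close>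

lemma ias_value_compact_sublevel:
  fixes F :: "real ^ 'n ^ 'm" and R :: "real ^ 'n ^ 'k"
  assumes ker: "{x. F *v x = 0} \<inter> {x. R *v x = 0} = {0}"
    and r: "r \<ge> 1" "rt \<ge> 1" and v: "\<And>i. v $ i > 0" "vt > 0" and eta: "eta > 0" "etat > 0"
  shows "compact {z \<in> ias_domain. ias_value F y R r rt v vt eta etat z \<le> c}"
proof -
  let ?f = "ias_value F y R r rt v vt eta etat"
  let ?Q = "\<lambda>i. gamma_potential r (v $ i) eta" and ?P = "gamma_potential rt vt etat"
  obtain m\<^sub>\<nu> where m\<^sub>\<nu>: "\<And>s. s > 0 \<Longrightarrow> m\<^sub>\<nu> \<le> ?P s"
    using gamma_potential_bounded_below[OF r(2) v(2) eta(2)] by blast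
  have "\<forall>i. \<exists>C. \<forall>s>0. C \<le> ?Q i s"
    using gamma_potential_bounded_below[OF r(1) v(1) eta(1)] by metis
  then obtain m where m: "\<And>i s. s > 0 \<Longrightarrow> m i \<le> ?Q i s" by metis
  define e where "e = c - m\<^sub>\<nu> - (\<Sum>i\<in>UNIV. m i)"
  obtain a\<^sub>\<nu> b\<^sub>\<nu> where \<nu>_box: "a\<^sub>\<nu> > 0" "\<And>s. s > 0 \<Longrightarrow> ?P s \<le> m\<^sub>\<nu> + e \<Longrightarrow> a\<^sub>\<nu> \<le> s \<and> s \<le> b\<^sub>\<nu>"
    using gamma_potential_sublevel[OF r(2) v(2) eta(2)] by blast
  have "\<forall>i. \<exists>a b. a > 0 \<and> (\<forall>s>0. ?Q i s \<le> m i + e \<longrightarrow> a \<le> s \<and> s \<le> b)"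
    using gamma_potential_sublevel[OF r(1) v(1) eta(1)] by metis
  then obtain a b where \<theta>_box: "\<And>i. a i > 0"
      "\<And>i s. s > 0 \<Longrightarrow> ?Q i s \<le> m i + e \<Longrightarrow> a i \<le> s \<and> s \<le> b i"
    by metis
  \<comment> \<open>This is at least \<open>2 * e * s\<close> for every denominator \<open>s\<close> that occurs in the
    sublevel set. As \<open>2 * e\<close> bounds each quotient, \<open>sqrt M\<close> bounds each \<open>norm u\<close>.\<close>
  define M where "M = 2 * e * (\<bar>b\<^sub>\<nu>\<bar> + (\<Sum>i\<in>UNIV. \<bar>b i\<bar>))"
  obtain d where d: "\<And>x. norm (F *v x - y) \<le> sqrt M \<Longrightarrow> (\<And>i. \<bar>(R *v x) $ i\<bar> \<le> sqrt M) \<Longrightarrow> norm x \<le> d"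
    using norm_bounded_by_residuals_of_trivial_kernels[OF ker] by blast
  define K where "K = cball (0 :: real ^ 'n) d \<times> cbox (\<chi> i. a i) (\<chi> i. b i) \<times> {a\<^sub>\<nu>..b\<^sub>\<nu>}"
  have "compact K" unfolding K_def by (intro compact_Times compact_cball compact_cbox compact_Icc)
  have K_sub: "K \<subseteq> ias_domain"
    using \<theta>_box(1) \<nu>_box(1)
    by (fastforce simp: K_def ias_domain_def mem_box_cart intro: less_le_trans)
  have sub_K: "z \<in> K" if z: "z \<in> ias_domain" "?f z \<le> c" for z
  proof -
    obtain x \<theta> \<nu> where z_eq: "z = (x, \<theta>, \<nu>)" by (cases z) auto
    have pos: "\<nu> > 0" "\<And>i. \<theta> $ i > 0" using z(1) by (auto simp: z_eq ias_domain_def)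
    define A B where "A = (norm (F *v x - y))\<^sup>2 / \<nu>"
      and "B = (\<lambda>i. (norm ((R *v x) $ i))\<^sup>2 / \<theta> $ i)"
    have A0: "0 \<le> A" and Bi0: "\<And>i. 0 \<le> B i" using pos by (auto simp: A_def B_def less_imp_le)
    have B0: "0 \<le> sum B UNIV" using Bi0 by (intro sum_nonneg)
    have Bi: "B i \<le> sum B UNIV" for i using Bi0 by (intro member_le_sum) auto
    have Q0: "0 \<le> (\<Sum>i\<in>UNIV. ?Q i (\<theta> $ i) - m i)" using m pos(2) by (intro sum_nonneg) simp
    have Qi: "?Q i (\<theta> $ i) - m i \<le> (\<Sum>i\<in>UNIV. ?Q i (\<theta> $ i) - m i)" for i
      using m pos(2) by (intro member_le_sum[of i UNIV "\<lambda>i. ?Q i (\<theta> $ i) - m i"]) auto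
    have P0: "0 \<le> ?P \<nu> - m\<^sub>\<nu>" using m\<^sub>\<nu> pos(1) by simp
    have "A / 2 + sum B UNIV / 2 + (?P \<nu> - m\<^sub>\<nu>) + (\<Sum>i\<in>UNIV. ?Q i (\<theta> $ i) - m i) \<le> e"
      using z(2) by (simp add: z_eq ias_value_def A_def B_def e_def sum_subtractf)
    then have le: "A \<le> 2 * e" "\<And>i. B i \<le> 2 * e" "?P \<nu> \<le> m\<^sub>\<nu> + e" "\<And>i. ?Q i (\<theta> $ i) \<le> m i + e"
      using A0 B0 Q0 P0 Bi Qi by (smt (verit) field_sum_of_halves)+
    have e0: "0 \<le> e" using le(1) A0 by simp
    have \<nu>: "a\<^sub>\<nu> \<le> \<nu> \<and> \<nu> \<le> b\<^sub>\<nu>" using \<nu>_box(2)[OF pos(1) le(3)] .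
    have \<theta>: "a i \<le> \<theta> $ i \<and> \<theta> $ i \<le> b i" for i using \<theta>_box(2)[OF pos(2) le(4)] .
    have b0: "0 \<le> (\<Sum>i\<in>UNIV. \<bar>b i\<bar>)" by (intro sum_nonneg) simp
    have "(norm (F *v x - y))\<^sup>2 = A * \<nu>" using pos by (simp add: A_def)
    also have "\<dots> \<le> 2 * e * (\<bar>b\<^sub>\<nu>\<bar> + (\<Sum>i\<in>UNIV. \<bar>b i\<bar>))"
      by (rule mult_mono[OF le(1)])
        (use \<nu> pos(1) e0 b0 in linarith)+
    finally have 1: "norm (F *v x - y) \<le> sqrt M" by (simp add: M_def real_le_rsqrt)
    have 2: "\<bar>(R *v x) $ i\<bar> \<le> sqrt M" for i
    proof -
      have "\<bar>b i\<bar> \<le> (\<Sum>i\<in>UNIV. \<bar>b i\<bar>)" by (intro member_le_sum) auto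
      have "\<bar>(R *v x) $ i\<bar>\<^sup>2 = B i * \<theta> $ i" using pos(2)[of i] by (simp add: B_def)
      also have "\<dots> \<le> 2 * e * (\<bar>b\<^sub>\<nu>\<bar> + (\<Sum>i\<in>UNIV. \<bar>b i\<bar>))"
        by (rule mult_mono[OF le(2)])
          (use \<theta>[of i] pos(2)[of i] e0 \<open>\<bar>b i\<bar> \<le> _\<close> in linarith)+
      finally show ?thesis unfolding M_def by (rule real_le_rsqrt)
    qed
    show ?thesis
      using d[OF 1 2] \<nu> \<theta> by (simp add: z_eq K_def mem_box_cart)
  qed
  have "continuous_on K ?f"
    by (intro continuous_at_imp_continuous_on ballI differentiable_imp_continuous_within
        ias_value_differentiable v subsetD[OF K_sub])
  then have "closed (K \<inter> ?f -` {..c})"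
    by (rule continuous_closed_preimage) (auto intro: compact_imp_closed \<open>compact K\<close>)
  with \<open>compact K\<close> have "compact (K \<inter> (K \<inter> ?f -` {..c}))" by (rule compact_Int_closed)
  moreover have "K \<inter> (K \<inter> ?f -` {..c}) = {z \<in> ias_domain. ?f z \<le> c}"
    using sub_K K_sub by auto
  ultimately show ?thesis by simp
qed

section \<open>The generalized IAS algorithm\<close>

text \<open>An infinite value off \<open>S\<close> confines the minimizers to \<open>S\<close>, provided that \<open>S\<close> has a point: a constantly
infinite objective is minimized everywhere.\<close>

lemma is_minimizer_iff_minimizes_on:
  assumes H: "\<And>u. H u = (if u \<in> S then ereal (h u) else \<infinity>)" and ne: "S \<noteq> {}"
  shows "is_minimizer H z \<longleftrightarrow> minimizes_on S h z"
proof
  assume *: "is_minimizer H z"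
  obtain w where w: "w \<in> S" using ne by blast
  have le: "H z \<le> H u" for u using * by (simp add: is_arg_min_linorder)
  have "z \<in> S" using le[of w] w H by (auto split: if_splits)
  moreover have "h z \<le> h u" if "u \<in> S" for u using le[of u] that \<open>z \<in> S\<close> by (simp add: H)
  ultimately show "minimizes_on S h z" by (simp add: minimizes_on_def)
next
  assume "minimizes_on S h z"
  then show "is_minimizer H z"
    by (simp add: minimizes_on_def is_arg_min_linorder H)
qed

lemma the_minimizer_is_minimizer:
  assumes "\<exists>!z. is_minimizer H z"
  shows "is_minimizer H (the_minimizer H)"
  unfolding the_minimizer_def using assms by (rule theI')

text \<open>Hypothesis \<open>sep\<close> says that \<open>f\<close> is a sum of a function of \<open>(x, \<theta>)\<close> and a function of \<open>(x, \<nu>)\<close>. It makes the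
\<open>\<theta>\<close>-minimizer independent of \<open>\<nu>\<close>, and it lets the two successive updates of \<open>\<theta>\<close> and \<open>\<nu>\<close> combine to a
joint minimizer over the pair.\<close>

lemma ias_step_minimizes:
  fixes f :: "(real ^ 'n) \<times> (real ^ 'k) \<times> real \<Rightarrow> real"
  assumes f: "strictly_convex_on ias_domain f" "continuous_on ias_domain f"
    and sub: "\<And>c. compact {z \<in> ias_domain. f z \<le> c}"
    and sep: "\<And>x \<theta> \<theta>' \<nu> \<nu>'. f (x, \<theta>, \<nu>) + f (x, \<theta>', \<nu>') = f (x, \<theta>, \<nu>') + f (x, \<theta>', \<nu>)"
    and G: "\<And>x \<theta> \<nu>. G x \<theta> \<nu> = (if (x, \<theta>, \<nu>) \<in> ias_domain then ereal (f (x, \<theta>, \<nu>)) else \<infinity>)"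
    and step: "ias_step G x = (x', p)"
  shows "minimizes_on ({\<theta>. \<forall>i. \<theta> $ i > 0} \<times> {0<..}) (\<lambda>q. f (x, q)) p"
    and "minimizes_on UNIV (\<lambda>u. f (u, p)) x'"
proof -
  let ?T = "{\<theta> :: real ^ 'k. \<forall>i. \<theta> $ i > 0}"
  note ex1 = ex1_minimizes_on_section[OF f sub convex_ias_domain]
  have "(\<chi> i. 1) \<in> ?T" by simp
  then have T: "?T \<noteq> {}" by blast
  define \<theta> where "\<theta> = theta_update G x"
  define \<nu> where "\<nu> = the_minimizer (\<lambda>\<nu>'. G x \<theta> \<nu>')"
  have p: "p = (\<theta>, \<nu>)" and x': "x' = the_minimizer (\<lambda>x''. G x'' \<theta> \<nu>)"
    using step by (simp_all add: ias_step_def Let_def \<theta>_def \<nu>_def)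
  have \<theta>_iff: "is_minimizer (\<lambda>\<theta>'. G x \<theta>' \<mu>) \<tau> \<longleftrightarrow> minimizes_on ?T (\<lambda>\<theta>'. f (x, \<theta>', 1)) \<tau>"
    if "\<mu> > 0" for \<mu> \<tau>
  proof -
    have "is_minimizer (\<lambda>\<theta>'. G x \<theta>' \<mu>) \<tau> \<longleftrightarrow> minimizes_on ?T (\<lambda>\<theta>'. f (x, \<theta>', \<mu>)) \<tau>"
      by (rule is_minimizer_iff_minimizes_on) (use that T in \<open>auto simp: G ias_domain_def\<close>)
    also have "f (x, \<tau>, \<mu>) \<le> f (x, \<theta>', \<mu>) \<longleftrightarrow> f (x, \<tau>, 1) \<le> f (x, \<theta>', 1)" for \<theta>'
      using sep[of x \<tau> \<mu> \<theta>' 1] by linarith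
    then have "minimizes_on ?T (\<lambda>\<theta>'. f (x, \<theta>', \<mu>)) \<tau> \<longleftrightarrow> minimizes_on ?T (\<lambda>\<theta>'. f (x, \<theta>', 1)) \<tau>"
      by (simp add: minimizes_on_def)
    finally show ?thesis .
  qed
  have "\<exists>!\<tau>. minimizes_on ?T (\<lambda>\<theta>'. f (x, \<theta>', 1)) \<tau>"
    by (rule ex1[of "{x} \<times> UNIV \<times> {1}" "\<lambda>\<theta>. (x, \<theta>, 1)"])
      (use T in \<open>auto simp: ias_domain_def inj_on_def intro!: closed_Times convex_Times\<close>)
  then have "\<exists>!\<tau>. \<forall>\<mu>>0. is_minimizer (\<lambda>\<theta>'. G x \<theta>' \<mu>) \<tau>"
    using \<theta>_iff by (metis zero_less_one)
  then have \<theta>_min: "\<forall>\<mu>>0. is_minimizer (\<lambda>\<theta>'. G x \<theta>' \<mu>) \<theta>"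
    unfolding \<theta>_def theta_update_def by (rule theI')
  have \<theta>1: "minimizes_on ?T (\<lambda>\<theta>'. f (x, \<theta>', 1)) \<theta>"
    by (rule iffD1[OF \<theta>_iff[OF zero_less_one] \<theta>_min[rule_format, OF zero_less_one]])
  then have \<theta>T: "\<theta> \<in> ?T" by (simp add: minimizes_on_def)
  have "is_minimizer (G x \<theta>) \<mu> \<longleftrightarrow> minimizes_on {0<..} (\<lambda>\<nu>'. f (x, \<theta>, \<nu>')) \<mu>" for \<mu>
    by (rule is_minimizer_iff_minimizes_on) (use \<theta>T in \<open>auto simp: G ias_domain_def\<close>)
  moreover have "\<exists>!\<mu>. minimizes_on {0<..} (\<lambda>\<nu>'. f (x, \<theta>, \<nu>')) \<mu>"
    by (rule ex1[of "{x} \<times> {\<theta>} \<times> UNIV" "\<lambda>\<nu>. (x, \<theta>, \<nu>)"])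
      (use \<theta>T in \<open>auto simp: ias_domain_def inj_on_def intro!: closed_Times convex_Times\<close>)
  ultimately have \<nu>_min: "minimizes_on {0<..} (\<lambda>\<nu>'. f (x, \<theta>, \<nu>')) \<nu>"
    using the_minimizer_is_minimizer[of "G x \<theta>"] by (simp add: \<nu>_def)
  then have \<nu>0: "\<nu> > 0" by (simp add: minimizes_on_def)
  show "minimizes_on (?T \<times> {0<..}) (\<lambda>q. f (x, q)) p"
    unfolding minimizes_on_def
  proof (intro conjI ballI)
    show "p \<in> ?T \<times> {0<..}" using p \<theta>T \<nu>0 by simp
    fix q assume "q \<in> ?T \<times> {0::real<..}"
    then obtain \<theta>' \<nu>' where q: "q = (\<theta>', \<nu>')" "\<theta>' \<in> ?T" "\<nu>' > 0" by blast
    have "f (x, \<theta>, \<nu>) \<le> f (x, \<theta>, \<nu>')" using \<nu>_min q(3) by (simp add: minimizes_on_def)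
    moreover have "f (x, \<theta>, 1) \<le> f (x, \<theta>', 1)" using \<theta>1 q(2) by (simp add: minimizes_on_def)
    ultimately show "f (x, p) \<le> f (x, q)"
      using sep[of x \<theta> \<nu>' \<theta>' 1] by (simp add: p q)
  qed
  have "is_minimizer (\<lambda>x''. G x'' \<theta> \<nu>) u \<longleftrightarrow> minimizes_on UNIV (\<lambda>u. f (u, \<theta>, \<nu>)) u" for u
    by (rule is_minimizer_iff_minimizes_on) (use \<theta>T \<nu>0 in \<open>auto simp: G ias_domain_def\<close>)
  moreover have "\<exists>!u. minimizes_on UNIV (\<lambda>u. f (u, \<theta>, \<nu>)) u"
    by (rule ex1[of "UNIV \<times> {(\<theta>, \<nu>)}" "\<lambda>u. (u, \<theta>, \<nu>)"])
      (use \<theta>T \<nu>0 in \<open>auto simp: ias_domain_def inj_on_def intro!: closed_Times convex_Times\<close>)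
  ultimately show "minimizes_on UNIV (\<lambda>u. f (u, p)) x'"
    using the_minimizer_is_minimizer[of "\<lambda>x''. G x'' \<theta> \<nu>"] by (simp add: x' p)
qed

theorem theorem3p4:
  fixes F :: "real ^ 'n ^ 'm" and y :: "real ^ 'm" and R :: "real ^ 'n ^ 'k"
    and r rt \<beta> \<beta>t vt eta etat :: real and v :: "real ^ 'k"
    and x0 :: "real ^ 'n"
    and G :: "real ^ 'n \<Rightarrow> real ^ 'k \<Rightarrow> real \<Rightarrow> ereal"
  assumes "{x. F *v x = 0} \<inter> {x. R *v x = 0} = {0}"
    and "r \<noteq> 0" and "rt \<noteq> 0"
    and "\<beta> > 0" and "\<beta>t > 0"
    and "\<And>i. v $ i > 0" and "vt > 0"
    and "eta = r * \<beta> - 3 / 2"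
    and "etat = rt * \<beta>t - (real CARD('m) + 2) / 2"
    and "G = ias_objective F y R r rt v vt eta etat"
    and "r \<ge> 1" and "rt \<ge> 1"
    and "eta > 0" and "etat > 0"
  shows "(\<exists>!z. is_minimizer (\<lambda>(x, \<theta>, \<nu>). G x \<theta> \<nu>) z) \<and>
         (\<lambda>k. ias_iterate G x0 k) \<longlonglongrightarrow> the_minimizer (\<lambda>(x, \<theta>, \<nu>). G x \<theta> \<nu>)"
proof -
  let ?f = "ias_value F y R r rt v vt eta etat"
  let ?P = "{\<theta> :: real ^ 'k. \<forall>i. \<theta> $ i > 0} \<times> {0::real<..}"
  let ?H = "\<lambda>(x, \<theta>, \<nu>). G x \<theta> \<nu>"
  have dom: "(ias_domain :: ((real ^ 'n) \<times> (real ^ 'k) \<times> real) set) = UNIV \<times> ?P"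
    by (simp add: ias_domain_def)
  have conv: "strictly_convex_on ias_domain ?f"
    by (rule ias_value_strictly_convex) (use assms in auto)
  have diff: "?f differentiable (at z)" if "z \<in> ias_domain" for z
    by (rule ias_value_differentiable) (use assms that in auto)
  have cont: "continuous_on ias_domain ?f"
    by (intro continuous_at_imp_continuous_on ballI differentiable_imp_continuous_within diff)
  have cvx: "convex (ias_domain :: ((real ^ 'n) \<times> (real ^ 'k) \<times> real) set)"
    by (rule convex_ias_domain)
  have sub: "compact {z \<in> ias_domain. ?f z \<le> c}" for c
    by (rule ias_value_compact_sublevel) (use assms in auto)
  \<comment> \<open>No term involves both \<open>\<theta>\<close> and \<open>\<nu>\<close>.\<close>
  have sep: "?f (x, \<theta>, \<nu>) + ?f (x, \<theta>', \<nu>') = ?f (x, \<theta>, \<nu>') + ?f (x, \<theta>', \<nu>)" for x \<theta> \<theta>' \<nu> \<nu>'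
    by (simp add: ias_value_def)
  have G: "G x \<theta> \<nu> = (if (x, \<theta>, \<nu>) \<in> ias_domain then ereal (?f (x, \<theta>, \<nu>)) else \<infinity>)" for x \<theta> \<nu>
    unfolding assms(10) by (rule ias_objective_eq)
  have "((\<chi> i. 1) :: real ^ 'k, 1 :: real) \<in> ?P" by simp
  then have ne: "(ias_domain :: ((real ^ 'n) \<times> (real ^ 'k) \<times> real) set) \<noteq> {}"
    unfolding dom by blast
  have iff: "is_minimizer ?H z \<longleftrightarrow> minimizes_on ias_domain ?f z" for z
    by (rule is_minimizer_iff_minimizes_on[OF _ ne]) (auto simp: G)
  have "\<exists>!z. minimizes_on (ias_domain \<inter> UNIV) ?f z"
    using conv cont sub convex_ias_domain closed_UNIV convex_UNIV
    by (rule ex1_minimizes_on_slice) (use ne in simp)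
  then have ex1: "\<exists>!z. is_minimizer ?H z" by (simp add: iff)
  have min: "minimizes_on ias_domain ?f (the_minimizer ?H)"
    by (rule iffD1[OF iff the_minimizer_is_minimizer[OF ex1]])
  define x p where "x k = fst (ias_iterate G x0 k)" and "p k = snd (ias_iterate G x0 k)" for k
  have "ias_step G (x k) = (x (Suc k), p (Suc k))" for k by (simp add: x_def p_def)
  note step = ias_step_minimizes[OF conv cont sub sep G this]
  have "open ?P" by (intro open_Times open_pos_orthant open_greaterThan)
  have "(\<lambda>k. (x k, p k)) \<longlonglongrightarrow> the_minimizer ?H"
    by (rule alternating_minimization_converges[where f = ?f and x = x and p = p, OF open_UNIV \<open>open ?P\<close>
          conv[unfolded dom] cvx[unfolded dom] diff[unfolded dom]
          sub[unfolded dom] step min[unfolded dom]])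
  then show ?thesis using ex1 by (simp add: x_def p_def)
qed

end
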